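(* Let $f\in\mathcal{H}_X$, where $\mathcal{H}_X$ is a real RKHS of functions on $X=\mathbb{R}^d$ uniformly embedded in $\mathcal{C}(X)$. Let $A\in\mathbb{R}^{d\times d}$ be Hurwitz, $B\in\mathbb{R}^{d\times 1}$, $\mu>0$, let $Q\in\mathbb{R}^{d\times d}$ be symmetric positive definite, and let $P\in\mathbb{R}^{d\times d}$ be the unique positive definite solution of $A^TP+PA=-Q$. Let $t\mapsto x(t)\in\mathbb{R}^d$, $t\ge 0$, be a trajectory of $\dot x(t)=Ax(t)+Bf(x(t))$, and let $\Omega\subseteq X$ be a non-empty subset such that the trajectory partially persistently excites $\Omega$ and the corresponding subspace $\mathcal{H}_\Omega$ of $\mathcal{H}_X$ in the sense of condition PE.1. Then for any initial condition $(\tilde x_0,\tilde f_0)\in\mathbb{R}^d\times\mathcal{H}_X$, the solution $(\tilde x(t),\tilde f(t))\in\mathbb{R}^d\times\mathcal{H}_X$, $t\ge 0$, of the error equations $$\dot{\tilde x}(t)=A\tilde x(t)+B\,\mathcal{E}_{x(t)}\tilde f(t),\qquad \dot{\tilde f}(t)=-\mu\,(B\mathcal{E}_{x(t)})^*P\,\tilde x(t)$$ satisfies $$\lim_{t\to\infty}\|\tilde x(t)\|=0\quad\text{and}\quad \lim_{t\to\infty}\|\mathbf{P}_\Omega\tilde f(t)\|_{\mathcal{H}_X}=0.$$ Moreover, writing $\tilde f(t,x)$ for the value of the function $\tilde f(t)\in\mathcal{H}_X$ at $x$, $$\lim_{t\to\infty}|\tilde f(t,x)|=0\quad\text{for all 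}x\in\Omega.$$
   Context: $\mathcal{H}_X$ is a real reproducing kernel Hilbert space (RKHS) of functions on $X=\mathbb{R}^d$ with reproducing kernel $\mathfrak{K}:X\times X\to\mathbb{R}$, and $\mathfrak{K}_x:=\mathfrak{K}(\cdot,x)$. For $x\in X$ the evaluation functional $\mathcal{E}_x:\mathcal{H}_X\to\mathbb{R}$ is $\mathcal{E}_xf=f(x)=\langle f,\mathfrak{K}_x\rangle_{\mathcal{H}_X}$; its adjoint is $\mathcal{E}_x^*\alpha=\alpha\,\mathfrak{K}_x$ for $\alpha\in\mathbb{R}$. The star denotes the adjoint of a bounded linear operator between Hilbert spaces, so $(B\mathcal{E}_x)^*v=(B^Tv)\,\mathfrak{K}_x$ for $v\in\mathbb{R}^d$. "$\mathcal{H}_X$ is uniformly embedded in $\mathcal{C}(X)$" means that all functions in $\mathcal{H}_X$ are continuous and there is a constant $\bar k<\infty$ with $\sqrt{\mathfrak{K}(x,x)}\le\bar k$ for all $x\in X$ (so that $\|f\|_\infty\le\bar k\|f\|_{\mathcal{H}_X}$ for all $f\in\mathcal{H}_X$). For non-empty $\Omega\subseteq X$, $\mathcal{H}_\Omega:=\overline{\mathrm{span}\{\mathfrak{K}_x:x\in\Omega\}}$ (closure in $\mathcal{H}_X$), and $\mathbf{P}_\Omega:\mathcal{H}_X\to\mathcal{H}_\Omega$ is the orthogonal projection. Condition PE.1: a trajectory $t\mapsto x(t)\in X$ persistently excites the subspace $\mathcal{H}_\Omega$ of $\mathcal{H}_X$ in the sense of PE.1 if there exist a constant $\gamma_1>0$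 and time constants $T_0,\delta,\Delta>0$ such that for each $t\ge T_0$ and any $g\in\mathcal{H}_X$ there exists $s\in[t,t+\Delta]$ such that $$\left|\int_s^{s+\delta}\mathcal{E}_{x(\tau)}g\,d\tau\right|\ge\gamma_1\|\mathbf{P}_\Omega g\|_{\mathcal{H}_X}.$$ The set $\Omega$ is called partially persistently excited when $\mathcal{H}_\Omega$ is persistently excited. The error equations arise from the adaptive estimator $\dot{\hat x}(t)=A\hat x(t)+B\mathcal{E}_{x(t)}\hat f(t)$, $\dot{\hat f}(t)=\mu(B\mathcal{E}_{x(t)})^*P(x(t)-\hat x(t))$, with $\tilde x=x-\hat x$ and $\tilde f(t)=f-\hat f(t)$. The matrix $A$ and vector $B$ are known, $f$ is the unknown function, and $\mu$ is the learning rate.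
   Formalization: The vector B is assumed to be nonzero; for B = 0 the claim fails (e.g. constant functions on ℝ, K = 1, A = -1: PE.1 holds but f̃(t) stays equal to f̃₀). *)

theory Defs
  imports "HOL-Analysis.Analysis"
begin

text \<open>
  A real RKHS of functions on a set of points \<open>'x\<close> is a real Hilbert space \<open>'h\<close> whose elements are
  identified with functions through an injective linear map \<open>ev\<close>: \<open>ev g\<close> is the function
  that \<open>g\<close> stands for, and \<open>\<lambda>g. ev g x\<close> is the evaluation functional at \<open>x\<close>.
\<close>

definition rkhs :: "('h::{real_inner,complete_space} \<Rightarrow> 'x \<Rightarrow> real) \<Rightarrow> ('x \<Rightarrow> 'x \<Rightarrow> real) \<Rightarrow> bool" where
  "rkhs ev K \<longleftrightarrow>
     (\<forall>g h x. ev (g + h) x = ev g x + ev h x) \<and>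
     (\<forall>c g x. ev (c *\<^sub>R g) x = c * ev g x) \<and>
     inj ev \<and>
     (\<forall>x. \<exists>k. ev k = (\<lambda>y. K y x) \<and> (\<forall>g. ev g x = g \<bullet> k))"

definition kernel_section :: "('h \<Rightarrow> 'x \<Rightarrow> real) \<Rightarrow> ('x \<Rightarrow> 'x \<Rightarrow> real) \<Rightarrow> 'x \<Rightarrow> 'h" where
  "kernel_section ev K x = (THE k. ev k = (\<lambda>y. K y x))"

definition uniformly_embedded ::
    "('h \<Rightarrow> 'x::topological_space \<Rightarrow> real) \<Rightarrow> ('x \<Rightarrow> 'x \<Rightarrow> real) \<Rightarrow> bool" where
  "uniformly_embedded ev K \<longleftrightarrow>
     (\<forall>g. continuous_on UNIV (ev g)) \<and> (\<exists>kbar. \<forall>x. sqrt (K x x) \<le> kbar)"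

definition rkhs_subspace ::
    "('h::real_inner \<Rightarrow> 'x \<Rightarrow> real) \<Rightarrow> ('x \<Rightarrow> 'x \<Rightarrow> real) \<Rightarrow> 'x set \<Rightarrow> 'h set" where
  "rkhs_subspace ev K \<Omega> = closure (span (kernel_section ev K ` \<Omega>))"

text \<open>
  The orthogonal projection onto \<open>S\<close>, meaningful when \<open>S\<close> is a closed subspace of a Hilbert space.
  The library's \<open>closest_point\<close> is restricted to spaces with the Heine-Borel property,
  i.e. to finite dimension.
\<close>

definition orth_proj :: "'h::real_inner set \<Rightarrow> 'h \<Rightarrow> 'h" where
  "orth_proj S g = (THE h. h \<in> S \<and> (\<forall>k\<in>S. orthogonal (g - h) k))"

text \<open>Only the values \<open>x t\<close> with \<open>t \<ge> 0\<close> matter, since \<open>T0 > 0\<close>.\<close>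

definition persistently_excites ::
    "('h::real_inner \<Rightarrow> 'x \<Rightarrow> real) \<Rightarrow> ('x \<Rightarrow> 'x \<Rightarrow> real) \<Rightarrow> 'x set \<Rightarrow> (real \<Rightarrow> 'x) \<Rightarrow> bool" where
  "persistently_excites ev K \<Omega> x \<longleftrightarrow>
     (\<exists>\<gamma> T0 \<delta> \<Delta>. \<gamma> > 0 \<and> T0 > 0 \<and> \<delta> > 0 \<and> \<Delta> > 0 \<and>
        (\<forall>t\<ge>T0. \<forall>g. \<exists>s\<in>{t..t + \<Delta>}.
           \<bar>integral {s..s + \<delta>} (\<lambda>\<tau>. ev g (x \<tau>))\<bar> \<ge> \<gamma> * norm (orth_proj (rkhs_subspace ev K \<Omega>) g)))"

text \<open>All complex eigenvalues of the real matrix have negative real part.\<close>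

definition hurwitz :: "real^'d^'d \<Rightarrow> bool" where
  "hurwitz A \<longleftrightarrow>
     (\<forall>(z::complex) v. v \<noteq> 0 \<and> map_matrix complex_of_real A *v v = z *s v \<longrightarrow> Re z < 0)"

definition sym_pos_def :: "real^'d^'d \<Rightarrow> bool" where
  "sym_pos_def Q \<longleftrightarrow> transpose Q = Q \<and> (\<forall>v. v \<noteq> 0 \<longrightarrow> v \<bullet> (Q *v v) > 0)"

lemma kernel_section:
  fixes ev :: "'h::{real_inner,complete_space} \<Rightarrow> 'x \<Rightarrow> real"
  assumes "rkhs ev K"
  shows "ev (kernel_section ev K x) = (\<lambda>y. K y x)"
    and "ev g x = g \<bullet> kernel_section ev K x"
proof -
  obtain k where k: "ev k = (\<lambda>y. K y x)" "\<And>g. ev g x = g \<bullet> k" and inj: "inj ev"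
    using assms unfolding rkhs_def by meson
  have "kernel_section ev K x = k"
    unfolding kernel_section_def using k(1) inj by (intro the_equality) (auto intro: injD)
  with k show "ev (kernel_section ev K x) = (\<lambda>y. K y x)" "ev g x = g \<bullet> kernel_section ev K x"
    by auto
qed

lemma adjoint_input_evaluation:
  fixes ev :: "'h::{real_inner,complete_space} \<Rightarrow> 'x \<Rightarrow> real" and B :: "real^'d"
  assumes "rkhs ev K"
  shows "adjoint (\<lambda>g. ev g x *\<^sub>R B) v = (B \<bullet> v) *\<^sub>R kernel_section ev K x"
proof -
  have "adjoint (\<lambda>g. ev g x *\<^sub>R B) = (\<lambda>v. (B \<bullet> v) *\<^sub>R kernel_section ev K x)"
    by (rule adjoint_unique) (simp add: kernel_section(2)[OF assms])
  then show ?thesis by simp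
qed

end

theory Submission
  imports Defs
begin

text \<open>
  The adaptation law is chosen so that the cross terms in the derivative of
  \<open>V = xe \<bullet> P xe + (norm fe)\<^sup>2 / \<mu>\<close> cancel, which leaves \<open>V' = - xe \<bullet> Q xe\<close> by the Lyapunov equation.
  Hence both errors stay bounded. Therefore \<open>xe\<close> has a bounded derivative because the kernel is bounded,
  and a nonnegative \<open>V\<close> cannot absorb infinitely many excursions of \<open>xe\<close> away from \<open>0\<close>. This gives
  \<open>xe \<rightarrow> 0\<close> (\<open>tendsto_zero_of_dissipation\<close>).

  Once \<open>xe\<close> is small, so is the velocity of \<open>fe\<close>, and on a window of bounded length \<open>fe\<close> is nearly
  constant. The equation for \<open>xe\<close> then expresses the integral of \<open>fe t\<close> along the trajectory, times
  \<open>B\<close>, as an increment of \<open>xe\<close> plus small terms (\<open>window_integral_bound\<close>). As \<open>B\<close> is not zero, the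
  integrals in the excitation condition for \<open>g = fe t\<close> tend to \<open>0\<close>, uniformly over the position of
  the window, and so does the projection of \<open>fe t\<close> that they dominate. A kernel section at a point
  of \<open>\<Omega>\<close> lies in the subspace, so the value of \<open>fe t\<close> there sees only the projection.

  The projection is given by a definite description. It denotes the intended vector because a closed
  convex set in a complete inner product space has a point nearest to any given one.
\<close>

section \<open>Orthogonal projection onto a closed subspace\<close>

text \<open>
  Almost nearest points are close to one another: by the parallelogram law, if two points of the
  convex set have squared distance at most \<open>D + r\<close> from \<open>a\<close> and their midpoint has squared distance
  at least \<open>D\<close>, then the two are at squared distance at most \<open>4 r\<close>. The sets of almost nearest points
  thus shrink, and completeness provides a common point.
\<close>

lemma closed_convex_nearest_point_exists:
  fixes S :: "'a::{real_inner,complete_space} set"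
  assumes "closed S" "convex S" "S \<noteq> {}"
  obtains p where "p \<in> S" "\<forall>z\<in>S. dist a p \<le> dist a z"
proof -
  define D where "D = (INF z\<in>S. (dist a z)\<^sup>2)"
  have bdd: "bdd_below ((\<lambda>z. (dist a z)\<^sup>2) ` S)"
    by (intro bdd_belowI2[where m = 0]) auto
  have D_le: "D \<le> (dist a z)\<^sup>2" if "z \<in> S" for z
    unfolding D_def using bdd that by (rule cINF_lower)
  define N where "N = (\<lambda>n. S \<inter> {z. (dist a z)\<^sup>2 \<le> D + inverse (real (Suc n))})"
  have close: "(dist u v)\<^sup>2 \<le> 4 * inverse (real (Suc n))" if "u \<in> N n" "v \<in> N n" for u v n
  proof -
    let ?m = "(1/2) *\<^sub>R u + (1/2) *\<^sub>R v"
    have "?m \<in> S"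
      using that \<open>convex S\<close> unfolding N_def by (intro convexD) auto
    then have "D \<le> (dist a ?m)\<^sup>2" by (rule D_le)
    moreover have "(dist u v)\<^sup>2 = 2 * (dist a u)\<^sup>2 + 2 * (dist a v)\<^sup>2 - 4 * (dist a ?m)\<^sup>2"
      by (simp add: dist_norm power2_norm_eq_inner inner_diff inner_add inner_commute algebra_simps)
    ultimately show ?thesis using that by (simp add: N_def)
  qed
  obtain p where p: "\<And>n. p \<in> N n"
  proof (rule decreasing_closed_nest[of N])
    show "closed (N n)" for n
      unfolding N_def using \<open>closed S\<close>
      by (intro closed_Int closed_Collect_le continuous_intros)
    show "N n \<noteq> {}" for n
    proof -
      have "(INF z\<in>S. (dist a z)\<^sup>2) < D + inverse (real (Suc n))"
        unfolding D_def[symmetric] by simp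
      then obtain z where "z \<in> S" "(dist a z)\<^sup>2 < D + inverse (real (Suc n))"
        using cINF_less_iff[OF \<open>S \<noteq> {}\<close> bdd] by auto
      then show ?thesis unfolding N_def by force
    qed
    show "N n \<subseteq> N m" if "m \<le> n" for m n
    proof -
      have "inverse (real (Suc n)) \<le> inverse (real (Suc m))"
        using that by (intro le_imp_inverse_le) auto
      then show ?thesis unfolding N_def by (auto simp del: of_nat_Suc intro: order_trans[OF _ add_left_mono])
    qed
    show "\<exists>n. \<forall>u\<in>N n. \<forall>v\<in>N n. dist u v < e" if "e > 0" for e
    proof -
      obtain n where n: "inverse (real (Suc n)) < e\<^sup>2 / 4"
        using reals_Archimedean[of "e\<^sup>2 / 4"] \<open>e > 0\<close> by auto
      have "dist u v < e" if "u \<in> N n" "v \<in> N n" for u v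
        using close[OF that] n \<open>e > 0\<close> by (intro power2_less_imp_less[of _ e]) auto
      then show ?thesis by blast
    qed
  qed (use that in blast)
  have "(dist a p)\<^sup>2 \<le> D"
  proof (rule field_le_epsilon)
    fix e :: real assume "e > 0"
    then obtain n where "inverse (real (Suc n)) < e"
      using reals_Archimedean by blast
    then show "(dist a p)\<^sup>2 \<le> D + e"
      using p[of n] unfolding N_def by simp
  qed
  then have "\<forall>z\<in>S. dist a p \<le> dist a z"
    using D_le by (meson order_trans power2_le_imp_le zero_le_dist)
  with p[of 0] show thesis by (intro that[of p]) (auto simp: N_def)
qed

text \<open>
  The vector from the nearest point \<open>p\<close> to \<open>g\<close> makes an obtuse angle with \<open>y - p\<close> for each \<open>y\<close> in
  the set. In a subspace, \<open>y\<close> may be both \<open>p + k\<close> and \<open>p - k\<close>, so the angle is a right one.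
\<close>

lemma orth_proj_closed_subspace:
  fixes S :: "'h::{real_inner,complete_space} set"
  assumes "closed S" "subspace S"
  shows "orth_proj S g \<in> S"
    and "k \<in> S \<Longrightarrow> g \<bullet> k = orth_proj S g \<bullet> k"
proof -
  obtain p where p: "p \<in> S" "\<forall>z\<in>S. dist g p \<le> dist g z"
    using closed_convex_nearest_point_exists[OF \<open>closed S\<close> subspace_imp_convex[OF \<open>subspace S\<close>]]
      subspace_0[OF \<open>subspace S\<close>] by blast
  have p_orth: "(g - p) \<bullet> k = 0" if "k \<in> S" for k
  proof -
    have "p + k \<in> S" "p - k \<in> S"
      using subspace_add subspace_diff \<open>subspace S\<close> p(1) that by blast+
    then have "(g - p) \<bullet> (p + k - p) \<le> 0" "(g - p) \<bullet> (p - k - p) \<le> 0"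
      using any_closest_point_dot[OF subspace_imp_convex[OF \<open>subspace S\<close>] \<open>closed S\<close> p(1) _ p(2)]
      by blast+
    then show ?thesis by simp
  qed
  have eq: "orth_proj S g = p"
    unfolding orth_proj_def
  proof (rule the_equality)
    show "p \<in> S \<and> (\<forall>k\<in>S. orthogonal (g - p) k)"
      using p(1) p_orth by (simp add: orthogonal_def)
    fix h assume h: "h \<in> S \<and> (\<forall>k\<in>S. orthogonal (g - h) k)"
    then have "h - p \<in> S" using subspace_diff \<open>subspace S\<close> p(1) by blast
    then have "(g - h) \<bullet> (h - p) = 0" "(g - p) \<bullet> (h - p) = 0"
      using h p_orth by (auto simp: orthogonal_def)
    then have "(h - p) \<bullet> (h - p) = 0" by (simp add: inner_diff_left)
    then show "h = p" by simp
  qed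
  show "orth_proj S g \<in> S" using eq p(1) by simp
  show "g \<bullet> k = orth_proj S g \<bullet> k" if "k \<in> S"
    using p_orth[OF that] eq by (simp add: inner_diff_left)
qed

lemma subspace_closure:
  fixes S :: "'a::real_normed_vector set"
  assumes "subspace S"
  shows "subspace (closure S)"
  unfolding subspace_def
proof (intro conjI ballI allI)
  show "0 \<in> closure S"
    using subspace_0[OF assms] closure_subset by blast
next
  fix u v assume "u \<in> closure S" "v \<in> closure S"
  then obtain a b where "\<forall>n. a n \<in> S" "a \<longlonglongrightarrow> u" "\<forall>n. b n \<in> S" "b \<longlonglongrightarrow> v"
    by (auto simp: closure_sequential)
  then have "\<forall>n. a n + b n \<in> S" "(\<lambda>n. a n + b n) \<longlonglongrightarrow> u + v"
    using subspace_add[OF assms] by (auto intro: tendsto_add)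
  then show "u + v \<in> closure S"
    unfolding closure_sequential by (intro exI conjI)
next
  fix c :: real and u assume "u \<in> closure S"
  then obtain a where "\<forall>n. a n \<in> S" "a \<longlonglongrightarrow> u"
    by (auto simp: closure_sequential)
  then have "\<forall>n. c *\<^sub>R a n \<in> S" "(\<lambda>n. c *\<^sub>R a n) \<longlonglongrightarrow> c *\<^sub>R u"
    using subspace_scale[OF assms] by (auto intro: tendsto_scaleR)
  then show "c *\<^sub>R u \<in> closure S"
    unfolding closure_sequential by (intro exI conjI)
qed

text \<open>
  Evaluation at \<open>y\<close> is the inner product with a kernel section that belongs to the subspace, so it
  ignores the component of \<open>g\<close> orthogonal to the subspace.
\<close>

lemma abs_eval_le_norm_orth_proj:
  fixes ev :: "'h::{real_inner,complete_space} \<Rightarrow> 'x \<Rightarrow> real"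
  assumes "rkhs ev K" "y \<in> \<Omega>"
  shows "\<bar>ev g y\<bar> \<le> norm (orth_proj (rkhs_subspace ev K \<Omega>) g) * norm (kernel_section ev K y)"
proof -
  let ?S = "rkhs_subspace ev K \<Omega>"
  have "kernel_section ev K y \<in> ?S"
    unfolding rkhs_subspace_def using assms(2) by (meson closure_subset imageI span_base subsetD)
  moreover have "closed ?S" "subspace ?S"
    unfolding rkhs_subspace_def by (auto intro: subspace_closure)
  ultimately have "ev g y = orth_proj ?S g \<bullet> kernel_section ev K y"
    using kernel_section(2)[OF assms(1)] orth_proj_closed_subspace(2) by metis
  then show ?thesis
    using Cauchy_Schwarz_ineq2 by metis
qed

section \<open>Kernel sections and quadratic forms\<close>

lemma norm_kernel_section:
  fixes ev :: "'h::{real_inner,complete_space} \<Rightarrow> 'x \<Rightarrow> real"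
  assumes "rkhs ev K"
  shows "norm (kernel_section ev K x) = sqrt (K x x)"
  unfolding norm_eq_sqrt_inner
  using kernel_section(1)[OF assms, of x] kernel_section(2)[OF assms, of _ x] by metis

lemma sym_pos_def_coercive:
  fixes Q :: "real^'d^'d"
  assumes "sym_pos_def Q"
  obtains q where "q > 0" "\<And>v. q * (norm v)\<^sup>2 \<le> v \<bullet> (Q *v v)"
proof -
  have "continuous_on (sphere 0 1) (\<lambda>v::real^'d. v \<bullet> (Q *v v))"
    by (intro continuous_intros)
  moreover have "axis undefined 1 \<in> sphere (0::real^'d) 1" by (simp add: norm_axis_1)
  ultimately obtain u where u: "u \<in> sphere (0::real^'d) 1"
    and min: "\<And>w. w \<in> sphere 0 1 \<Longrightarrow> u \<bullet> (Q *v u) \<le> w \<bullet> (Q *v w)"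
    using continuous_attains_inf[OF compact_sphere, of "0::real^'d" 1 "\<lambda>v. v \<bullet> (Q *v v)"]
    by blast
  have "u \<noteq> 0" using u by auto
  have "u \<bullet> (Q *v u) * (norm v)\<^sup>2 \<le> v \<bullet> (Q *v v)" for v
  proof (cases "v = 0")
    case False
    have "u \<bullet> (Q *v u) \<le> (v /\<^sub>R norm v) \<bullet> (Q *v (v /\<^sub>R norm v))"
      using False by (intro min) simp
    also have "\<dots> = (v \<bullet> (Q *v v)) / (norm v)\<^sup>2"
      by (simp add: matrix_vector_mult_scaleR power2_eq_square divide_inverse)
    finally show ?thesis using False by (simp add: field_simps)
  qed simp
  moreover have "u \<bullet> (Q *v u) > 0"
    using assms \<open>u \<noteq> 0\<close> unfolding sym_pos_def_def by blast
  ultimately show thesis by (rule that[rotated])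
qed

lemma sym_pos_def_inner_commute:
  assumes "sym_pos_def P"
  shows "u \<bullet> (P *v v) = v \<bullet> (P *v u)"
  using assms unfolding sym_pos_def_def
  by (metis dot_lmul_matrix inner_commute vector_transpose_matrix)

lemma lyapunov_equation_quadratic_form:
  fixes A P Q :: "real^'d^'d"
  assumes "transpose A ** P + P ** A = - Q" "sym_pos_def P"
  shows "2 * ((A *v v) \<bullet> (P *v v)) = - (v \<bullet> (Q *v v))"
proof -
  have "- (v \<bullet> (Q *v v)) = v \<bullet> ((transpose A ** P + P ** A) *v v)"
    unfolding assms(1) using matrix_vector_mult_diff_rdistrib[of 0 Q v] by simp
  also have "\<dots> = v \<bullet> (transpose A *v (P *v v)) + v \<bullet> (P *v (A *v v))"
    by (simp add: matrix_vector_mult_add_rdistrib matrix_vector_mul_assoc inner_add_right)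
  also have "v \<bullet> (transpose A *v (P *v v)) = (A *v v) \<bullet> (P *v v)"
    by (metis dot_lmul_matrix inner_commute transpose_matrix_vector)
  also have "v \<bullet> (P *v (A *v v)) = (A *v v) \<bullet> (P *v v)"
    using sym_pos_def_inner_commute[OF assms(2)] .
  finally show ?thesis by simp
qed

lemma norm_matrix_vector_le:
  fixes A :: "real^'n^'m"
  shows "norm (A *v v) \<le> onorm ((*v) A) * norm v"
  by (rule onorm) simp

section \<open>Increments and a Barbalat-type lemma\<close>

lemma norm_increment_le:
  fixes h :: "real \<Rightarrow> 'a::real_normed_vector"
  assumes "a \<le> b"
    and "\<And>t. t \<in> {a..b} \<Longrightarrow> (h has_vector_derivative h' t) (at t within {a..b})"
    and "\<And>t. t \<in> {a..b} \<Longrightarrow> norm (h' t) \<le> c"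
  shows "norm (h b - h a) \<le> c * (b - a)"
proof -
  have "onorm (\<lambda>r. r *\<^sub>R h' t) \<le> c" if "t \<in> {a..b}" for t
    using assms(3)[OF that] order_trans[OF norm_ge_zero assms(3)[OF that]]
    by (intro onorm_bound) (auto simp: mult.commute[of c] intro: mult_left_mono)
  then have "norm (h b - h a) \<le> c * norm (b - a)"
    using assms(1,2) unfolding has_vector_derivative_def
    by (intro differentiable_bound[of "{a..b}" h "\<lambda>t r. r *\<^sub>R h' t"]) auto
  then show ?thesis using \<open>a \<le> b\<close> by simp
qed

lemma real_increment_le:
  fixes V :: "real \<Rightarrow> real"
  assumes "a \<le> b"
    and "\<And>t. t \<in> {a..b} \<Longrightarrow> (V has_vector_derivative V' t) (at t within {a..b})"
    and "\<And>t. t \<in> {a..b} \<Longrightarrow> V' t \<le> c"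
  shows "V b - V a \<le> c * (b - a)"
proof -
  obtain t where "t \<in> {a..b}" "V b - V a = (b - a) *\<^sub>R V' t"
    using mvt_very_simple[of a b V "\<lambda>t r. r *\<^sub>R V' t"] assms(1,2)
    unfolding has_vector_derivative_def by auto
  then show ?thesis
    using assms(1) mult_right_mono[OF assms(3), of t "b - a"] by (simp add: mult.commute)
qed

text \<open>
  A nonincreasing \<open>V \<ge> 0\<close> converges, so its decrease over windows of a fixed length tends to \<open>0\<close>.
  If \<open>y\<close> has norm at least \<open>e\<close> at some time then, by the bound \<open>L\<close> on its speed, it keeps norm at
  least \<open>e / 2\<close> for a time \<open>e / (2 L)\<close>, during which \<open>V\<close> drops by a fixed amount. This can therefore
  not happen at late times.
\<close>

lemma tendsto_zero_of_dissipation: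
  fixes y :: "real \<Rightarrow> 'a::real_normed_vector" and V :: "real \<Rightarrow> real"
  assumes V': "\<And>t. t \<ge> 0 \<Longrightarrow> (V has_vector_derivative V' t) (at t within {0..})"
    and dissip: "\<And>t. t \<ge> 0 \<Longrightarrow> V' t \<le> - q * (norm (y t))\<^sup>2"
    and nonneg: "\<And>t. t \<ge> 0 \<Longrightarrow> V t \<ge> 0"
    and y': "\<And>t. t \<ge> 0 \<Longrightarrow> (y has_vector_derivative y' t) (at t within {0..})"
    and speed: "\<And>t. t \<ge> 0 \<Longrightarrow> norm (y' t) \<le> L"
    and "q > 0" "L > 0"
  shows "(y \<longlongrightarrow> 0) at_top"
proof -
  have decr: "V b - V a \<le> c * (b - a)"
    if "0 \<le> a" "a \<le> b" "\<And>t. t \<in> {a..b} \<Longrightarrow> V' t \<le> c" for a b c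
    using that
    by (intro real_increment_le[where V' = V'] has_vector_derivative_within_subset[OF V']) auto
  have mono: "V b \<le> V a" if "0 \<le> a" "a \<le> b" for a b
  proof -
    have "V' t \<le> 0" if "t \<in> {a..b}" for t
      using dissip[of t] that \<open>0 \<le> a\<close> \<open>q > 0\<close> by (smt (verit) atLeastAtMost_iff mult_nonneg_nonneg
          mult_minus_left zero_le_power2)
    from decr[OF \<open>0 \<le> a\<close> \<open>a \<le> b\<close> this] show ?thesis by simp
  qed
  define l where "l = (INF t\<in>{0..}. V t)"
  have bdd: "bdd_below (V ` {0..})"
    using nonneg by (intro bdd_belowI2[where m = 0]) auto
  have l_le: "l \<le> V t" if "t \<ge> 0" for t
    unfolding l_def using bdd that by (intro cINF_lower) auto
  have "\<exists>T. \<forall>t\<ge>T. norm (y t) < e" if "e > 0" for e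
  proof -
    define h where "h = e / (2 * L)"
    have "h > 0" using \<open>e > 0\<close> \<open>L > 0\<close> by (simp add: h_def)
    define r where "r = q * (e / 2)\<^sup>2 * h"
    have "r > 0" using \<open>e > 0\<close> \<open>q > 0\<close> \<open>h > 0\<close> by (simp add: r_def)
    then have "(INF t\<in>{0..}. V t) < l + r" unfolding l_def by simp
    then obtain T where "T \<ge> 0" "V T < l + r"
      using cINF_less_iff[OF _ bdd, of "l + r"] by auto
    have "norm (y t) < e" if "t \<ge> T" for t
    proof (rule ccontr)
      assume "\<not> norm (y t) < e"
      have "t \<ge> 0" using that \<open>T \<ge> 0\<close> by simp
      have "e / 2 \<le> norm (y s)" if "s \<in> {t..t + h}" for s
      proof -
        have "norm (y s - y t) \<le> L * (s - t)"
          using that \<open>t \<ge> 0\<close> speed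
          by (intro norm_increment_le[where h' = y'] has_vector_derivative_within_subset[OF y'])
            auto
        also have "\<dots> \<le> L * h" using that \<open>L > 0\<close> by (intro mult_left_mono) auto
        also have "\<dots> = e / 2" using \<open>L > 0\<close> by (simp add: h_def)
        finally have "norm (y s - y t) \<le> e / 2" .
        then show ?thesis
          using \<open>\<not> norm (y t) < e\<close> norm_triangle_ineq3[of "y s" "y t"] by linarith
      qed
      then have "V' s \<le> - q * (e / 2)\<^sup>2" if "s \<in> {t..t + h}" for s
      proof -
        have "q * (e / 2)\<^sup>2 \<le> q * (norm (y s))\<^sup>2"
          using \<open>\<And>s. s \<in> {t..t + h} \<Longrightarrow> e / 2 \<le> norm (y s)\<close>[OF that] \<open>q > 0\<close> \<open>e > 0\<close>
          by (intro mult_left_mono power_mono) auto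
        then show ?thesis using dissip[of s] that \<open>t \<ge> 0\<close> by simp
      qed
      then have "V (t + h) - V t \<le> - r"
        using decr[of t "t + h" "- q * (e / 2)\<^sup>2"] \<open>t \<ge> 0\<close> \<open>h > 0\<close> by (simp add: r_def)
      moreover have "V t \<le> V T" using mono \<open>T \<ge> 0\<close> that by blast
      moreover have "l \<le> V (t + h)" using l_le \<open>t \<ge> 0\<close> \<open>h > 0\<close> by simp
      ultimately show False using \<open>V T < l + r\<close> by linarith
    qed
    then show ?thesis by blast
  qed
  then show ?thesis
    unfolding tendsto_iff eventually_at_top_linorder by simp
qed

section \<open>Integrals along the trajectory for a constant parameter\<close>

text \<open>
  Subtract from the state \<open>y\<close> the vector \<open>B\<close> times the integral of \<open>\<phi> t \<bullet> k\<close>, in which the parameter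
  \<open>\<phi>\<close> is held at its value at time \<open>t\<close>. What is left has derivative \<open>a + ((\<phi> - \<phi> t) \<bullet> k) B\<close>, which is
  small when the drift \<open>a\<close> is small and \<open>\<phi>\<close> moves slowly. Since \<open>y\<close> itself is small, the integral has to
  be small as well.
\<close>

lemma window_integral_bound:
  fixes y a :: "real \<Rightarrow> 'a::real_normed_vector" and \<phi> k :: "real \<Rightarrow> 'h::real_inner"
  assumes y': "\<And>\<tau>. \<tau> \<in> {t..b} \<Longrightarrow>
      (y has_vector_derivative a \<tau> + (\<phi> \<tau> \<bullet> k \<tau>) *\<^sub>R B) (at \<tau> within {t..b})"
    and \<phi>': "\<And>\<tau>. \<tau> \<in> {t..b} \<Longrightarrow> (\<phi> has_vector_derivative \<phi>' \<tau>) (at \<tau> within {t..b})"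
    and cont: "continuous_on {t..b} (\<lambda>\<tau>. \<phi> t \<bullet> k \<tau>)"
    and y_le: "\<And>\<tau>. \<tau> \<in> {t..b} \<Longrightarrow> norm (y \<tau>) \<le> \<eta>"
    and a_le: "\<And>\<tau>. \<tau> \<in> {t..b} \<Longrightarrow> norm (a \<tau>) \<le> \<alpha>"
    and \<phi>'_le: "\<And>\<tau>. \<tau> \<in> {t..b} \<Longrightarrow> norm (\<phi>' \<tau>) \<le> \<beta>"
    and k_le: "\<And>\<tau>. \<tau> \<in> {t..b} \<Longrightarrow> norm (k \<tau>) \<le> \<kappa>"
    and order: "t \<le> s" "s \<le> r" "r \<le> b"
  shows "\<bar>integral {s..r} (\<lambda>\<tau>. \<phi> t \<bullet> k \<tau>)\<bar> * norm B
    \<le> 2 * \<eta> + (\<alpha> + \<beta> * (b - t) * \<kappa> * norm B) * (r - s)"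
proof -
  define J where "J = (\<lambda>u. integral {s..u} (\<lambda>\<tau>. \<phi> t \<bullet> k \<tau>))"
  define h where "h = (\<lambda>u. y u - J u *\<^sub>R B)"
  have J': "(J has_vector_derivative \<phi> t \<bullet> k \<tau>) (at \<tau> within {s..r})" if "\<tau> \<in> {s..r}" for \<tau>
    unfolding J_def using that order
    by (intro integral_has_vector_derivative continuous_on_subset[OF cont]) auto
  have h': "(h has_vector_derivative a \<tau> + ((\<phi> \<tau> - \<phi> t) \<bullet> k \<tau>) *\<^sub>R B) (at \<tau> within {s..r})"
    if "\<tau> \<in> {s..r}" for \<tau>
  proof -
    have "((\<lambda>u. J u *\<^sub>R B) has_vector_derivative (\<phi> t \<bullet> k \<tau>) *\<^sub>R B) (at \<tau> within {s..r})"
      by (rule bounded_linear.has_vector_derivative[OF bounded_linear_scaleR_left J'[OF that]])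
    moreover have "(y has_vector_derivative a \<tau> + (\<phi> \<tau> \<bullet> k \<tau>) *\<^sub>R B) (at \<tau> within {s..r})"
      using that order by (intro has_vector_derivative_within_subset[OF y']) auto
    ultimately have "(h has_vector_derivative
        a \<tau> + (\<phi> \<tau> \<bullet> k \<tau>) *\<^sub>R B - (\<phi> t \<bullet> k \<tau>) *\<^sub>R B) (at \<tau> within {s..r})"
      unfolding h_def by (rule has_vector_derivative_diff[rotated])
    then show ?thesis by (simp add: inner_diff_left scaleR_diff_left add_diff_eq)
  qed
  have "norm (a \<tau> + ((\<phi> \<tau> - \<phi> t) \<bullet> k \<tau>) *\<^sub>R B) \<le> \<alpha> + \<beta> * (b - t) * \<kappa> * norm B"
    if "\<tau> \<in> {s..r}" for \<tau>
  proof -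
    have \<tau>: "\<tau> \<in> {t..b}" "t \<le> \<tau>" using that order by auto
    have "0 \<le> \<beta>" using \<phi>'_le[OF \<tau>(1)] norm_ge_zero order_trans by blast
    have "norm (\<phi> \<tau> - \<phi> t) \<le> \<beta> * (\<tau> - t)"
      using \<tau> \<phi>'_le
      by (intro norm_increment_le[where h' = \<phi>'] has_vector_derivative_within_subset[OF \<phi>']) auto
    also have "\<dots> \<le> \<beta> * (b - t)" using \<tau> \<open>0 \<le> \<beta>\<close> by (intro mult_left_mono) auto
    finally have "\<bar>(\<phi> \<tau> - \<phi> t) \<bullet> k \<tau>\<bar> \<le> \<beta> * (b - t) * \<kappa>"
      using k_le[OF \<tau>(1)] Cauchy_Schwarz_ineq2[of "\<phi> \<tau> - \<phi> t" "k \<tau>"]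
      by (meson mult_mono norm_ge_zero order_trans)
    then have "norm (((\<phi> \<tau> - \<phi> t) \<bullet> k \<tau>) *\<^sub>R B) \<le> \<beta> * (b - t) * \<kappa> * norm B"
      by (simp add: mult_right_mono)
    then show ?thesis using a_le[OF \<tau>(1)] by (rule norm_triangle_mono[rotated])
  qed
  from norm_increment_le[OF \<open>s \<le> r\<close> h' this]
  have h_le: "norm (h r - h s) \<le> (\<alpha> + \<beta> * (b - t) * \<kappa> * norm B) * (r - s)" .
  have J_eq: "J r *\<^sub>R B = y r - y s - (h r - h s)"
    by (simp add: h_def J_def)
  have "norm (J r *\<^sub>R B) \<le> norm (y r) + norm (y s) + norm (h r - h s)"
    unfolding J_eq
    using norm_triangle_ineq4[of "y r - y s" "h r - h s"] norm_triangle_ineq4[of "y r" "y s"]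
    by linarith
  moreover have "norm (y r) \<le> \<eta>" "norm (y s) \<le> \<eta>" using y_le order by auto
  ultimately show ?thesis using h_le by (simp add: J_def)
qed

section \<open>Convergence of the estimation errors\<close>

theorem theorem2:
  fixes ev :: "'h::{real_inner,complete_space} \<Rightarrow> real^'d \<Rightarrow> real"
    and K :: "real^'d \<Rightarrow> real^'d \<Rightarrow> real"
    and f :: 'h
    and A P Q :: "real^'d^'d"
    and B :: "real^'d"
    and \<mu> :: real
    and x :: "real \<Rightarrow> real^'d"
    and \<Omega> :: "(real^'d) set"
    and xe0 :: "real^'d" and fe0 :: 'h
    and xe :: "real \<Rightarrow> real^'d" and fe :: "real \<Rightarrow> 'h"
  assumes "rkhs ev K"
    and "uniformly_embedded ev K"
    and "hurwitz A"
    and "B \<noteq> 0"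
    and "\<mu> > 0"
    and "sym_pos_def Q"
    and "sym_pos_def P"
    and "transpose A ** P + P ** A = - Q"
    and "\<And>t. t \<ge> 0 \<Longrightarrow>
           (x has_vector_derivative (A *v x t + ev f (x t) *\<^sub>R B)) (at t within {0..})"
    and "\<Omega> \<noteq> {}"
    and "persistently_excites ev K \<Omega> x"
    and "xe 0 = xe0"
    and "fe 0 = fe0"
    and "\<And>t. t \<ge> 0 \<Longrightarrow>
           (xe has_vector_derivative (A *v xe t + ev (fe t) (x t) *\<^sub>R B)) (at t within {0..})"
    and "\<And>t. t \<ge> 0 \<Longrightarrow>
           (fe has_vector_derivative (- \<mu> *\<^sub>R adjoint (\<lambda>g. ev g (x t) *\<^sub>R B) (P *v xe t)))
             (at t within {0..})"
  shows "((\<lambda>t. norm (xe t)) \<longlongrightarrow> 0) at_top \<and>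
         ((\<lambda>t. norm (orth_proj (rkhs_subspace ev K \<Omega>) (fe t))) \<longlongrightarrow> 0) at_top \<and>
         (\<forall>y\<in>\<Omega>. ((\<lambda>t. \<bar>ev (fe t) y\<bar>) \<longlongrightarrow> 0) at_top)"
proof -
  note rk = assms(1) and ue = assms(2) and mu = \<open>\<mu> > 0\<close>
    and Q = \<open>sym_pos_def Q\<close> and P = \<open>sym_pos_def P\<close>
  define k where "k = (\<lambda>t. kernel_section ev K (x t))"
  define proj where "proj = orth_proj (rkhs_subspace ev K \<Omega>)"
  have ev_k: "ev g (x t) = g \<bullet> k t" for g t
    unfolding k_def by (rule kernel_section(2)[OF rk])
  obtain \<kappa> where \<kappa>: "\<And>t. norm (k t) \<le> \<kappa>"
    using ue unfolding uniformly_embedded_def k_def norm_kernel_section[OF rk] by auto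
  have "0 \<le> \<kappa>" using \<kappa>[of 0] norm_ge_zero order_trans by blast
  have xe': "(xe has_vector_derivative A *v xe t + (fe t \<bullet> k t) *\<^sub>R B) (at t within {0..})"
    if "t \<ge> 0" for t
    using assms(14)[OF that] unfolding ev_k .
  have fe': "(fe has_vector_derivative (- \<mu> * (B \<bullet> (P *v xe t))) *\<^sub>R k t) (at t within {0..})"
    if "t \<ge> 0" for t
    using assms(15)[OF that] unfolding adjoint_input_evaluation[OF rk] k_def scaleR_scaleR .

  \<comment> \<open>The cross terms \<open>2 * (fe t \<bullet> k t) * (B \<bullet> (P *v xe t))\<close> come with opposite signs.\<close>
  define V where "V = (\<lambda>t. xe t \<bullet> (P *v xe t) + (fe t \<bullet> fe t) / \<mu>)"
  have V': "(V has_vector_derivative - (xe t \<bullet> (Q *v xe t))) (at t within {0..})"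
    if "t \<ge> 0" for t
  proof -
    let ?dx = "A *v xe t + (fe t \<bullet> k t) *\<^sub>R B"
    let ?df = "(- \<mu> * (B \<bullet> (P *v xe t))) *\<^sub>R k t"
    have "((\<lambda>t. P *v xe t) has_vector_derivative P *v ?dx) (at t within {0..})"
      by (rule bounded_linear.has_vector_derivative[OF matrix_vector_mul_bounded_linear xe'[OF that]])
    then have "((\<lambda>t. xe t \<bullet> (P *v xe t)) has_vector_derivative
        xe t \<bullet> (P *v ?dx) + ?dx \<bullet> (P *v xe t)) (at t within {0..})"
      by (rule bounded_bilinear.has_vector_derivative[OF bounded_bilinear_inner xe'[OF that]])
    moreover have "((\<lambda>t. (fe t \<bullet> fe t) / \<mu>) has_vector_derivative
        (fe t \<bullet> ?df + ?df \<bullet> fe t) / \<mu>) (at t within {0..})"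
      by (intro bounded_linear.has_vector_derivative[OF bounded_linear_divide]
          bounded_bilinear.has_vector_derivative[OF bounded_bilinear_inner] fe' that)
    ultimately have "(V has_vector_derivative (xe t \<bullet> (P *v ?dx) + ?dx \<bullet> (P *v xe t))
        + (fe t \<bullet> ?df + ?df \<bullet> fe t) / \<mu>) (at t within {0..})"
      unfolding V_def by (rule has_vector_derivative_add)
    moreover have "(xe t \<bullet> (P *v ?dx) + ?dx \<bullet> (P *v xe t)) + (fe t \<bullet> ?df + ?df \<bullet> fe t) / \<mu>
        = - (xe t \<bullet> (Q *v xe t))"
    proof -
      have "xe t \<bullet> (P *v ?dx) = ?dx \<bullet> (P *v xe t)"
        by (rule sym_pos_def_inner_commute[OF P])
      moreover have "?dx \<bullet> (P *v xe t)
          = (A *v xe t) \<bullet> (P *v xe t) + (fe t \<bullet> k t) * (B \<bullet> (P *v xe t))"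
        by (simp add: inner_add_left)
      moreover have "(fe t \<bullet> ?df + ?df \<bullet> fe t) / \<mu> = - 2 * ((fe t \<bullet> k t) * (B \<bullet> (P *v xe t)))"
        using mu by (simp add: inner_commute)
      ultimately show ?thesis
        using lyapunov_equation_quadratic_form[OF assms(8) P, of "xe t"] by linarith
    qed
    ultimately show ?thesis by simp
  qed
  obtain q where q: "q > 0" "\<And>v. q * (norm v)\<^sup>2 \<le> v \<bullet> (Q *v v)"
    using sym_pos_def_coercive[OF Q] by blast
  obtain p where p: "p > 0" "\<And>v. p * (norm v)\<^sup>2 \<le> v \<bullet> (P *v v)"
    using sym_pos_def_coercive[OF P] by blast
  have p_nonneg: "0 \<le> p * (norm v)\<^sup>2" for v :: "real^'d" using p(1) by simp
  have q_nonneg: "0 \<le> q * (norm v)\<^sup>2" for v :: "real^'d" using q(1) by simp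
  have V_ge: "p * (norm (xe t))\<^sup>2 + (norm (fe t))\<^sup>2 / \<mu> \<le> V t" for t
    unfolding V_def using p(2)[of "xe t"] by (simp add: power2_norm_eq_inner)
  have V_nonneg: "0 \<le> V t" for t
    using V_ge[of t] p_nonneg[of "xe t"] mu by (smt (verit) divide_nonneg_pos zero_le_power2)
  have V_le: "V t \<le> V 0" if "t \<ge> 0" for t
  proof -
    have "- (xe s \<bullet> (Q *v xe s)) \<le> 0" for s
      using q(2)[of "xe s"] q_nonneg[of "xe s"] by linarith
    then have "V t - V 0 \<le> 0 * (t - 0)"
      using that
      by (intro real_increment_le[where V' = "\<lambda>s. - (xe s \<bullet> (Q *v xe s))"]
          has_vector_derivative_within_subset[OF V']) auto
    then show ?thesis by simp
  qed
  define Mx where "Mx = sqrt (V 0 / p)"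
  define Mf where "Mf = sqrt (V 0 * \<mu>)"
  have xe_le: "norm (xe t) \<le> Mx" if "t \<ge> 0" for t
  proof -
    have "p * (norm (xe t))\<^sup>2 \<le> V 0"
      using V_ge[of t] V_le[OF that] mu by (smt (verit) divide_nonneg_pos zero_le_power2)
    then show ?thesis
      unfolding Mx_def using p(1) by (intro real_le_rsqrt) (simp add: field_simps)
  qed
  have fe_le: "norm (fe t) \<le> Mf" if "t \<ge> 0" for t
  proof -
    have "(norm (fe t))\<^sup>2 / \<mu> \<le> V 0"
      using V_ge[of t] V_le[OF that] p_nonneg[of "xe t"] by linarith
    then show ?thesis
      unfolding Mf_def using mu by (intro real_le_rsqrt) (simp add: field_simps)
  qed
  define nA where "nA = onorm ((*v) A)"
  define nP where "nP = onorm ((*v) P)"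
  have nA: "norm (A *v v) \<le> nA * norm v" and nP: "norm (P *v v) \<le> nP * norm v" for v
    unfolding nA_def nP_def by (rule norm_matrix_vector_le)+
  have "0 \<le> nA" "0 \<le> nP" unfolding nA_def nP_def by (auto intro: onorm_pos_le)

  \<comment> \<open>The summand 1 only makes the bound on the speed positive.\<close>
  define L where "L = nA * Mx + Mf * \<kappa> * norm B + 1"
  have speed: "norm (A *v xe t + (fe t \<bullet> k t) *\<^sub>R B) \<le> L" if "t \<ge> 0" for t
  proof -
    have "norm (A *v xe t) \<le> nA * Mx"
      using nA[of "xe t"] xe_le[OF that] \<open>0 \<le> nA\<close> by (meson mult_left_mono order_trans)
    moreover have "\<bar>fe t \<bullet> k t\<bar> \<le> Mf * \<kappa>"
      using Cauchy_Schwarz_ineq2[of "fe t" "k t"] fe_le[OF that] \<kappa>[of t]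
      by (meson mult_mono norm_ge_zero order_trans)
    then have "norm ((fe t \<bullet> k t) *\<^sub>R B) \<le> Mf * \<kappa> * norm B"
      by (simp add: mult_right_mono)
    ultimately show ?thesis
      unfolding L_def using norm_triangle_ineq[of "A *v xe t" "(fe t \<bullet> k t) *\<^sub>R B"] by linarith
  qed
  have "L > 0"
  proof -
    have "0 \<le> Mx" "0 \<le> Mf"
      using xe_le[of 0] fe_le[of 0] norm_ge_zero order_trans by blast+
    then show ?thesis unfolding L_def using \<open>0 \<le> nA\<close> \<open>0 \<le> \<kappa>\<close>
      by (intro add_nonneg_pos add_nonneg_nonneg mult_nonneg_nonneg) auto
  qed
  have xe_lim: "(xe \<longlongrightarrow> 0) at_top"
    using q(2) V_nonneg speed \<open>q > 0\<close> \<open>L > 0\<close>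
    by (intro tendsto_zero_of_dissipation[OF V' _ _ xe', of q L]) auto

  obtain \<gamma> T0 \<delta> \<Delta> where pe: "\<gamma> > 0" "T0 > 0" "\<delta> > 0" "\<Delta> > 0"
    and excite: "\<And>t g. t \<ge> T0 \<Longrightarrow> \<exists>s\<in>{t..t + \<Delta>}.
        \<gamma> * norm (proj g) \<le> \<bar>integral {s..s + \<delta>} (\<lambda>\<tau>. ev g (x \<tau>))\<bar>"
    using assms(11) unfolding persistently_excites_def proj_def[symmetric]
    by (elim exE conjE) (rule that, assumption+, simp)
  have cont_ev: "continuous_on {a..b} (\<lambda>\<tau>. g \<bullet> k \<tau>)" if "a \<ge> 0" for a b g
  proof -
    have "continuous_on {0..} x"
      using assms(9) by (intro continuous_on_vector_derivative) auto
    then have "continuous_on {a..b} x"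
      using that by (elim continuous_on_subset) auto
    moreover have "continuous_on UNIV (ev g)"
      using ue unfolding uniformly_embedded_def by blast
    ultimately have "continuous_on {a..b} (\<lambda>\<tau>. ev g (x \<tau>))"
      using continuous_on_compose2 by blast
    then show ?thesis unfolding ev_k .
  qed

  \<comment> \<open>On \<open>{t..t + \<Delta> + \<delta>}\<close>, which contains every window admitted at time \<open>t\<close>, a bound \<open>\<eta>\<close> on \<open>xe\<close> bounds
    the drift \<open>A *v xe\<close> and the velocity of \<open>fe\<close> linearly in \<open>\<eta>\<close>; \<open>C\<close> collects the resulting factors.\<close>
  define C where "C = 2 + (nA + \<mu> * norm B * nP * \<kappa> * (\<Delta> + \<delta>) * \<kappa> * norm B) * \<delta>"
  have "C > 0"
    unfolding C_def using \<open>0 \<le> nA\<close> \<open>0 \<le> nP\<close> \<open>0 \<le> \<kappa>\<close> mu pe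
    by (intro add_pos_nonneg mult_nonneg_nonneg add_nonneg_nonneg) auto
  have proj_le: "\<gamma> * norm B * norm (proj (fe t)) \<le> C * \<eta>"
    if "t \<ge> T0" and small: "\<And>\<tau>. \<tau> \<ge> t \<Longrightarrow> norm (xe \<tau>) \<le> \<eta>" for t \<eta>
  proof -
    have "t \<ge> 0" using \<open>t \<ge> T0\<close> pe(2) by simp
    have "0 \<le> \<eta>" using small[of t] norm_ge_zero order_trans by blast
    obtain s where s: "s \<in> {t..t + \<Delta>}"
      and ex: "\<gamma> * norm (proj (fe t)) \<le> \<bar>integral {s..s + \<delta>} (\<lambda>\<tau>. fe t \<bullet> k \<tau>)\<bar>"
      using excite[OF \<open>t \<ge> T0\<close>, of "fe t"] unfolding ev_k by blast
    have drift: "norm (A *v xe \<tau>) \<le> nA * \<eta>" if "\<tau> \<ge> t" for \<tau>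
      using nA[of "xe \<tau>"] small[OF that] \<open>0 \<le> nA\<close> by (meson mult_left_mono order_trans)
    have slow: "norm ((- \<mu> * (B \<bullet> (P *v xe \<tau>))) *\<^sub>R k \<tau>) \<le> \<mu> * (norm B * (nP * \<eta>)) * \<kappa>"
      if "\<tau> \<ge> t" for \<tau>
    proof -
      have "norm (P *v xe \<tau>) \<le> nP * \<eta>"
        using nP[of "xe \<tau>"] small[OF that] \<open>0 \<le> nP\<close> by (meson mult_left_mono order_trans)
      then have "\<bar>B \<bullet> (P *v xe \<tau>)\<bar> \<le> norm B * (nP * \<eta>)"
        using Cauchy_Schwarz_ineq2[of B "P *v xe \<tau>"] by (meson mult_left_mono norm_ge_zero order_trans)
      then have "\<bar>- \<mu> * (B \<bullet> (P *v xe \<tau>))\<bar> \<le> \<mu> * (norm B * (nP * \<eta>))"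
        using mu by (simp add: abs_mult)
      then show ?thesis
        using \<kappa>[of \<tau>] unfolding norm_scaleR by (meson abs_ge_zero mult_mono norm_ge_zero order_trans)
    qed
    have "\<bar>integral {s..s + \<delta>} (\<lambda>\<tau>. fe t \<bullet> k \<tau>)\<bar> * norm B
        \<le> 2 * \<eta> + (nA * \<eta> + \<mu> * (norm B * (nP * \<eta>)) * \<kappa> * (t + \<Delta> + \<delta> - t) * \<kappa> * norm B)
            * (s + \<delta> - s)"
      using \<open>t \<ge> 0\<close> s pe small drift slow \<kappa>
      by (intro window_integral_bound[where a = "\<lambda>\<tau>. A *v xe \<tau>" and y = xe
            and \<phi>' = "\<lambda>\<tau>. (- \<mu> * (B \<bullet> (P *v xe \<tau>))) *\<^sub>R k \<tau>"]
          has_vector_derivative_within_subset[OF xe'] has_vector_derivative_within_subset[OF fe']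
          cont_ev) auto
    also have "\<dots> = C * \<eta>" by (simp add: C_def algebra_simps)
    finally have "\<bar>integral {s..s + \<delta>} (\<lambda>\<tau>. fe t \<bullet> k \<tau>)\<bar> * norm B \<le> C * \<eta>" .
    moreover have "\<gamma> * norm (proj (fe t)) * norm B
        \<le> \<bar>integral {s..s + \<delta>} (\<lambda>\<tau>. fe t \<bullet> k \<tau>)\<bar> * norm B"
      using ex by (intro mult_right_mono) auto
    ultimately show ?thesis by (simp add: mult.commute mult.left_commute)
  qed
  have proj_lim: "((\<lambda>t. norm (proj (fe t))) \<longlongrightarrow> 0) at_top"
    unfolding tendsto_iff
  proof (intro allI impI)
    fix e :: real assume "e > 0"
    have "\<gamma> * norm B > 0" using pe(1) \<open>B \<noteq> 0\<close> by simp
    define \<eta> where "\<eta> = \<gamma> * norm B * e / (2 * C)"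
    have "\<eta> > 0" unfolding \<eta>_def using \<open>\<gamma> * norm B > 0\<close> \<open>e > 0\<close> \<open>C > 0\<close> by simp
    then have "eventually (\<lambda>t. norm (xe t) < \<eta>) at_top"
      using xe_lim unfolding tendsto_iff by simp
    then obtain T where T: "\<And>\<tau>. \<tau> \<ge> T \<Longrightarrow> norm (xe \<tau>) < \<eta>"
      unfolding eventually_at_top_linorder by blast
    have "dist (norm (proj (fe t))) 0 < e" if "t \<ge> max T T0" for t
    proof -
      have "\<gamma> * norm B * norm (proj (fe t)) \<le> C * \<eta>"
        using that by (intro proj_le less_imp_le[OF T]) auto
      also have "\<dots> = \<gamma> * norm B * (e / 2)" unfolding \<eta>_def using \<open>C > 0\<close> by simp
      finally have "norm (proj (fe t)) \<le> e / 2"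
        using \<open>\<gamma> * norm B > 0\<close> by (simp only: mult_le_cancel_left_pos)
      then show ?thesis using \<open>e > 0\<close> by simp
    qed
    then show "eventually (\<lambda>t. dist (norm (proj (fe t))) 0 < e) at_top"
      unfolding eventually_at_top_linorder by blast
  qed
  have "((\<lambda>t. \<bar>ev (fe t) z\<bar>) \<longlongrightarrow> 0) at_top" if "z \<in> \<Omega>" for z
  proof (rule tendsto_sandwich[OF _ _ tendsto_const])
    show "((\<lambda>t. norm (proj (fe t)) * norm (kernel_section ev K z)) \<longlongrightarrow> 0) at_top"
      using tendsto_mult_left_zero[OF proj_lim] .
    show "\<forall>\<^sub>F t in at_top. \<bar>ev (fe t) z\<bar> \<le> norm (proj (fe t)) * norm (kernel_section ev K z)"
      unfolding proj_def by (intro always_eventually allI abs_eval_le_norm_orth_proj[OF rk that])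
  qed simp
  then show ?thesis
    using tendsto_norm_zero[OF xe_lim] proj_lim unfolding proj_def by blast
qed

end
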